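(* Let $m\ge 3$ be odd and define $\mathrm{CYC}^*_m := \{(a,b,c)\in(\mathbb{Z}/m\mathbb{Z})^3 : a+b+c=0,\ b-a\in\{0,1\}\}\setminus\{(0,0,0)\}$. Then $\mathrm{NRD}(\mathrm{CYC}^*_m,n)\le O_m(n^{m/(m-1)})$ (with implied constant depending only on $m$), and $\mathrm{CYC}^*_m$ does not admit a Mal'tsev embedding.
   Context: For a finite set $D$ and relation $R\subseteq D^r$, an instance of $\mathrm{CSP}(R)$ is a pair $(X,Y)$, $X$ a finite variable set, $Y\subseteq X^r$; an assignment $\sigma:X\to D$ satisfies $y=(y_1,\dots,y_r)$ if $(\sigma(y_1),\dots,\sigma(y_r))\in R$. The instance is non-redundant if for each $y\in Y$ some assignment satisfies all of $Y\setminus\{y\}$ but not $y$; $\mathrm{NRD}(R,n)$ is the maximum $|Y|$ over non-redundant instances with $|X|=n$. A relation $P\subseteq D^r$ admits a Mal'tsev embedding if there are a set $E$ (finite or infinite), an injective $\sigma:D\to E$, a relation $Q\subseteq E^r$ with $Q\cap\sigma(D)^r=\sigma(P)$, and $\varphi:E^3\to E$ with $\varphi(a,a,b)=\varphi(b,a,a)=b$ for all $a,b$, such that $\varphi$ applied componentwise to any three tuples of $Q$ gives a tuple of $Q$. *)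

theory Defs
  imports Complex_Main "HOL-Library.NList" "HOL-Library.FuncSet" "HOL-Library.Landau_Symbols"
begin

text \<open>
  An \<open>r\<close>-tuple over a set \<open>A\<close> is a list in \<^term>\<open>nlists r A\<close>; applying a map to a tuple
  componentwise is \<^const>\<open>map\<close>.
\<close>

definition csp_instance :: "nat \<Rightarrow> 'v set \<Rightarrow> 'v list set \<Rightarrow> bool" where
  "csp_instance r X Y \<longleftrightarrow> finite X \<and> Y \<subseteq> nlists r X"

definition satisfies :: "'d list set \<Rightarrow> ('v \<Rightarrow> 'd) \<Rightarrow> 'v list \<Rightarrow> bool" where
  "satisfies R \<sigma> y \<longleftrightarrow> map \<sigma> y \<in> R"

definition nonredundant :: "'d set \<Rightarrow> 'd list set \<Rightarrow> 'v set \<Rightarrow> 'v list set \<Rightarrow> bool" where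
  "nonredundant D R X Y \<longleftrightarrow>
     (\<forall>y\<in>Y. \<exists>\<sigma>\<in>X \<rightarrow> D. (\<forall>y'\<in>Y - {y}. satisfies R \<sigma> y') \<and> \<not> satisfies R \<sigma> y)"

text \<open>
  Variables are natural numbers, which loses nothing because variable sets are finite. The set
  below is nonempty (take \<open>Y = {}\<close>) and bounded by \<open>n ^ r\<close>, so the maximum exists.
\<close>

definition NRD :: "'d set \<Rightarrow> nat \<Rightarrow> 'd list set \<Rightarrow> nat \<Rightarrow> nat" where
  "NRD D r R n =
     Max {card Y | (X :: nat set) Y. card X = n \<and> csp_instance r X Y \<and> nonredundant D R X Y}"

definition maltsev_on :: "'e set \<Rightarrow> ('e \<Rightarrow> 'e \<Rightarrow> 'e \<Rightarrow> 'e) \<Rightarrow> bool" where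
  "maltsev_on E \<phi> \<longleftrightarrow>
     (\<forall>a\<in>E. \<forall>b\<in>E. \<forall>c\<in>E. \<phi> a b c \<in> E) \<and>
     (\<forall>a\<in>E. \<forall>b\<in>E. \<phi> a a b = b \<and> \<phi> b a a = b)"

definition componentwise3 ::
    "('e \<Rightarrow> 'e \<Rightarrow> 'e \<Rightarrow> 'e) \<Rightarrow> nat \<Rightarrow> 'e list \<Rightarrow> 'e list \<Rightarrow> 'e list \<Rightarrow> 'e list" where
  "componentwise3 \<phi> r t u v = map (\<lambda>i. \<phi> (t ! i) (u ! i) (v ! i)) [0..<r]"

text \<open>
  HOL cannot quantify over types inside a formula, so the type \<open>'e\<close> containing the set \<open>E\<close> is a
  parameter: non-embeddability in the mathematical sense is the negation of this predicate with
  \<open>'e\<close> a free type variable of the theorem.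
\<close>

definition admits_maltsev_embedding ::
    "'e itself \<Rightarrow> 'd set \<Rightarrow> nat \<Rightarrow> 'd list set \<Rightarrow> bool" where
  "admits_maltsev_embedding _ D r P \<longleftrightarrow>
     (\<exists>(E :: 'e set) \<sigma> Q \<phi>.
        \<sigma> \<in> D \<rightarrow> E \<and> inj_on \<sigma> D \<and>
        Q \<subseteq> nlists r E \<and> Q \<inter> nlists r (\<sigma> ` D) = map \<sigma> ` P \<and>
        maltsev_on E \<phi> \<and>
        (\<forall>t\<in>Q. \<forall>u\<in>Q. \<forall>v\<in>Q. componentwise3 \<phi> r t u v \<in> Q))"

text \<open>\<open>\<int>/m\<int>\<close> is represented by the least nonnegative residues.\<close>

definition Zmod :: "nat \<Rightarrow> int set" where
  "Zmod m = {0..<int m}"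

definition CYC_star :: "nat \<Rightarrow> int list set" where
  "CYC_star m =
     {[a, b, c] | a b c. a \<in> Zmod m \<and> b \<in> Zmod m \<and> c \<in> Zmod m \<and>
        (a + b + c) mod int m = 0 \<and> (b - a) mod int m \<in> {0, 1}} - {[0, 0, 0]}"

end

theory Submission
  imports Defs "HOL-Library.Function_Algebras"
begin

text \<open>
  The pairs \<open>(a, b)\<close> with \<open>b - a \<in> {0, 1}\<close> are the edges of a \<open>2m\<close>-cycle, and \<open>c\<close> takes the same
  value exactly on opposite edges.

  Upper bound. Split a non-redundant instance according to whether the witness of a constraint
  \<open>y\<close> violates even the relation with \<open>(0, 0, 0)\<close> put back. If it does, an embedding of the full
  relation as a linear equation over the complex numbers makes these constraints linearly
  independent, so there are at most \<open>3n\<close> of them. Otherwise the witness maps \<open>y\<close> to the removed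
  edge and all other constraints into the remaining path of length \<open>2m - 1\<close>; so in the bipartite
  graph of the first two entries, a walk around an edge has at least \<open>2m - 1\<close> steps, and the Moore
  bound applies.

  No Mal'tsev embedding. A Mal'tsev operation generates operations on words of odd length that are
  invariant under cancellation of adjacent equal letters. So a tuple lies in \<open>Q\<close> as soon as its
  entries can be obtained by such cancellation from a word of tuples of \<open>Q\<close>, and \<open>(0, 0, 0)\<close> can be
  obtained in this way from the other edges.
\<close>

section \<open>Catalan operations\<close>

text \<open>
  Word operations \<open>t\<^sub>n\<close> (\<open>n\<close> odd) with \<open>t\<^sub>n (u x x v) = t\<^sub>n\<^sub>-\<^sub>2 (u v)\<close>: stage \<open>j\<close> corrects the
  previous stage so that cancellation at position \<open>j\<close> holds, without destroying it at smaller
  positions, in the way horns are filled in a simplicial Mal'tsev algebra.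
\<close>

primrec catalan_stage ::
    "('e \<Rightarrow> 'e \<Rightarrow> 'e \<Rightarrow> 'e) \<Rightarrow> ('e list \<Rightarrow> 'e) \<Rightarrow> nat \<Rightarrow> 'e list \<Rightarrow> 'e" where
  "catalan_stage \<phi> t 0 xs = hd xs"
| "catalan_stage \<phi> t (Suc j) xs =
     \<phi> (catalan_stage \<phi> t j xs) (catalan_stage \<phi> t j (xs[Suc j := xs ! j]))
       (t (take j xs @ drop (j + 2) xs))"

primrec catalan :: "('e \<Rightarrow> 'e \<Rightarrow> 'e \<Rightarrow> 'e) \<Rightarrow> nat \<Rightarrow> 'e list \<Rightarrow> 'e" where
  "catalan \<phi> 0 xs = hd xs"
| "catalan \<phi> (Suc k) xs = catalan_stage \<phi> (catalan \<phi> k) (2 * k + 2) xs"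

definition catalan_word :: "('e \<Rightarrow> 'e \<Rightarrow> 'e \<Rightarrow> 'e) \<Rightarrow> 'e list \<Rightarrow> 'e" where
  "catalan_word \<phi> xs = catalan \<phi> (length xs div 2) xs"

text \<open>Outer induction on \<open>k\<close>; inside it, stage \<open>j\<close> is shown to
  cancel at all positions below \<open>j\<close>, so the last stage \<open>2 * k + 2\<close> covers
  every position.\<close>

lemma catalan_cancel:
  assumes \<phi>: "\<And>a b. \<phi> a a b = b" "\<And>a b. \<phi> b a a = b"
    and "length xs = 2 * k + 3" "i < 2 * k + 2" "xs ! i = xs ! Suc i"
  shows "catalan \<phi> (Suc k) xs = catalan \<phi> k (take i xs @ drop (i + 2) xs)"
  using assms(3-)
proof (induction k arbitrary: i xs)
  case (0)
  then obtain a b c where "xs = [a, b, c]"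
    by (auto simp: eval_nat_numeral length_Suc_conv)
  with 0 \<phi> show ?case
    by (auto simp: less_Suc_eq numeral_2_eq_2)
next
  case (Suc k)
  note IH = Suc.IH
  let ?t = "catalan \<phi> (Suc k)"
  \<comment> \<open>In the step to \<open>Suc j\<close>: if \<open>i = j\<close>, the first two
    arguments of \<open>\<phi>\<close> agree and the third is left; if \<open>i < j\<close>, the
    last two agree and the first is left.\<close>
  have stage: "catalan_stage \<phi> ?t j ys = ?t (take i ys @ drop (i + 2) ys)"
    if "j \<le> 2 * k + 4" "length ys = 2 * k + 5" "i < j" "ys ! i = ys ! Suc i" for i j ys
    using that
  proof (induction j arbitrary: i ys)
    case 0
    then show ?case by simp
  next
    case (Suc j)
    let ?ys = "ys[Suc j := ys ! j]"
    let ?z = "take j ys @ drop (j + 2) ys"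
    show ?case
    proof (cases "i = j")
      case True
      then have "?ys = ys"
        using Suc.prems by (metis list_update_id)
      with True \<phi> show ?thesis
        by simp
    next
      case False
      then have ij: "i < j"
        using Suc.prems by simp
      have 1: "catalan_stage \<phi> ?t j ys = ?t (take i ys @ drop (i + 2) ys)"
        using Suc.prems ij by (intro Suc.IH) auto
      have 2: "catalan_stage \<phi> ?t j ?ys = ?t (take i ?ys @ drop (i + 2) ?ys)"
        using Suc.prems ij by (intro Suc.IH) (auto simp: nth_list_update)
      have "?t (take i ?ys @ drop (i + 2) ?ys) = ?t ?z"
      proof (cases "Suc i = j")
        case True
        have "take i ?ys @ drop (i + 2) ?ys = ?z"
          using Suc.prems True
          by (intro nth_equalityI) (auto simp: nth_append nth_list_update less_Suc_eq)
        then show ?thesis by simp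
      next
        case False
        with ij obtain j' where j: "j = i + 2 + j'"
          by (metis Suc_leI add_2_eq_Suc' le_Suc_ex le_neq_implies_less)
        \<comment> \<open>Each of the two words still contains a pair, at \<open>j - 2\<close> and
          at \<open>i\<close> respectively. Deleting it by the outer induction hypothesis gives the
          same word, which lacks both pairs.\<close>
        have "?t (take i ?ys @ drop (i + 2) ?ys)
          = catalan \<phi> k (take (i + j') (take i ?ys @ drop (i + 2) ?ys)
              @ drop (i + j' + 2) (take i ?ys @ drop (i + 2) ?ys))"
          using Suc.prems j
          by (intro IH) (auto simp: nth_append nth_list_update)
        also have "\<dots> = catalan \<phi> k (take i ?z @ drop (i + 2) ?z)"
          using Suc.prems j
          by (intro arg_cong[of _ _ "catalan \<phi> k"] nth_equalityI)
            (auto simp: nth_append nth_list_update min_def)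
        also have "\<dots> = ?t ?z"
          using Suc.prems j
          by (intro IH[symmetric]) (auto simp: nth_append nth_list_update)
        finally show ?thesis .
      qed
      then show ?thesis
        by (simp only: catalan_stage.simps 1 2 \<phi>)
    qed
  qed
  have "catalan_stage \<phi> ?t (2 * Suc k + 2) xs = ?t (take i xs @ drop (i + 2) xs)"
    using Suc.prems by (intro stage) auto
  then show ?case
    by (simp only: catalan.simps(2)[of _ "Suc k"])
qed

lemma catalan_word_cancel:
  assumes "\<And>a b. \<phi> a a b = b" "\<And>a b. \<phi> b a a = b" and "odd (length (u @ v))"
  shows "catalan_word \<phi> (u @ [x, x] @ v) = catalan_word \<phi> (u @ v)"
proof -
  obtain k where k: "length u + length v = 2 * k + 1"
    using assms(3) by (metis length_append oddE)
  have "catalan \<phi> (Suc k) (u @ [x, x] @ v)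
      = catalan \<phi> k (take (length u) (u @ [x, x] @ v) @ drop (length u + 2) (u @ [x, x] @ v))"
    using k by (intro catalan_cancel assms) (auto simp: nth_append)
  moreover have "length (u @ [x, x] @ v) div 2 = Suc k" "length (u @ v) div 2 = k"
    using k by auto
  ultimately show ?thesis
    by (simp add: catalan_word_def del: catalan.simps)
qed

text \<open>Replacing and deleting entries act on the list of tuples, in all coordinates at once, so
  a stage is a composition of componentwise applications of \<open>\<phi>\<close> to members of
  \<open>Q\<close>.\<close>

lemma catalan_stage_closed:
  assumes \<phi>: "\<And>t u v. t \<in> Q \<Longrightarrow> u \<in> Q \<Longrightarrow> v \<in> Q \<Longrightarrow> componentwise3 \<phi> r t u v \<in> Q"
    and t: "\<And>ts. set ts \<subseteq> Q \<Longrightarrow> length ts = n \<Longrightarrow>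
      map (\<lambda>i. t (map (\<lambda>q. q ! i) ts)) [0..<r] \<in> Q"
    and Q: "\<And>q. q \<in> Q \<Longrightarrow> length q = r"
    and "set ts \<subseteq> Q" "length ts = n + 2" "j \<le> Suc n"
  shows "map (\<lambda>i. catalan_stage \<phi> t j (map (\<lambda>q. q ! i) ts)) [0..<r] \<in> Q"
  using assms(4-)
proof (induction j arbitrary: ts)
  case 0
  then obtain q where q: "hd ts = q" "q \<in> Q" "ts \<noteq> []"
    by (cases ts) auto
  then have "map (\<lambda>i. catalan_stage \<phi> t 0 (map (\<lambda>q. q ! i) ts)) [0..<r] = q"
    using Q[of q] by (intro nth_equalityI) (auto simp: hd_map)
  with q show ?case by simp
next
  case (Suc j)
  let ?c = "\<lambda>ts j. map (\<lambda>i. catalan_stage \<phi> t j (map (\<lambda>q. q ! i) ts)) [0..<r]"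
  let ?d = "map (\<lambda>i. t (map (\<lambda>q. q ! i) (take j ts @ drop (j + 2) ts))) [0..<r]"
  have "ts ! j \<in> Q"
    using Suc.prems by (intro subsetD[OF Suc.prems(1)] nth_mem) simp
  have 1: "?c ts j \<in> Q"
    using Suc.prems by (intro Suc.IH) auto
  have 2: "?c (ts[Suc j := ts ! j]) j \<in> Q"
    using Suc.prems \<open>ts ! j \<in> Q\<close>
    by (intro Suc.IH) (auto dest!: subsetD[OF set_update_subset_insert])
  have 3: "?d \<in> Q"
    using Suc.prems by (intro t) (auto dest: in_set_takeD in_set_dropD)
  have "?c ts (Suc j) = componentwise3 \<phi> r (?c ts j) (?c (ts[Suc j := ts ! j]) j) ?d"
    using Suc.prems
    by (auto simp: componentwise3_def map_update take_map drop_map)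
  with \<phi>[OF 1 2 3] show ?case by simp
qed

lemma catalan_word_closed:
  assumes \<phi>: "\<And>t u v. t \<in> Q \<Longrightarrow> u \<in> Q \<Longrightarrow> v \<in> Q \<Longrightarrow> componentwise3 \<phi> r t u v \<in> Q"
    and Q: "\<And>q. q \<in> Q \<Longrightarrow> length q = r"
    and "set ts \<subseteq> Q" "odd (length ts)"
  shows "map (\<lambda>i. catalan_word \<phi> (map (\<lambda>q. q ! i) ts)) [0..<r] \<in> Q"
proof -
  have "map (\<lambda>i. catalan \<phi> k (map (\<lambda>q. q ! i) ts)) [0..<r] \<in> Q"
    if "length ts = 2 * k + 1" "set ts \<subseteq> Q" for k ts
    using that
  proof (induction k arbitrary: ts)
    case 0
    then obtain q where q: "ts = [q]" "q \<in> Q"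
      by (auto simp: length_Suc_conv)
    then have "map (\<lambda>i. catalan \<phi> 0 (map (\<lambda>q. q ! i) ts)) [0..<r] = q"
      using Q[of q] by (intro nth_equalityI) auto
    with q show ?case by simp
  next
    case (Suc k)
    then show ?case
      unfolding catalan.simps by (intro catalan_stage_closed[OF \<phi> _ Q, of "2 * k + 1"]) auto
  qed
  with assms show ?thesis
    by (auto simp: catalan_word_def elim!: oddE)
qed

section \<open>Words modulo cancellation\<close>

text \<open>Equality in the free product of groups of order two, one per letter: \<open>@\<close>
  multiplies and \<open>rev\<close> inverts.\<close>

inductive cancel_eq :: "'a list \<Rightarrow> 'a list \<Rightarrow> bool" (infix "\<approx>" 50) where
  same [simp, intro!]: "u \<approx> u"
| add_pair: "u \<approx> p @ q \<Longrightarrow> u \<approx> p @ [x, x] @ q"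
| drop_pair: "u \<approx> p @ [x, x] @ q \<Longrightarrow> u \<approx> p @ q"

lemma cancel_eq_trans [trans]:
  assumes "u \<approx> v" "v \<approx> w"
  shows "u \<approx> w"
  using assms(2,1) by induction (blast intro: cancel_eq.intros)+

lemma cancel_eq_sym: "u \<approx> v \<Longrightarrow> v \<approx> u"
proof (induction rule: cancel_eq.induct)
  case (add_pair u p q x)
  have "p @ [x, x] @ q \<approx> p @ q"
    by (rule cancel_eq.drop_pair) (rule cancel_eq.same)
  with add_pair show ?case
    by (blast intro: cancel_eq_trans)
next
  case (drop_pair u p x q)
  have "p @ q \<approx> p @ [x, x] @ q"
    by (rule cancel_eq.add_pair) (rule cancel_eq.same)
  with drop_pair show ?case
    by (blast intro: cancel_eq_trans)
qed auto

lemma cancel_eq_context: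
  assumes "u \<approx> v"
  shows "a @ u @ b \<approx> a @ v @ b"
  using assms
proof induction
  case (add_pair u p q x)
  then show ?case
    using cancel_eq.add_pair[of "a @ u @ b" "a @ p" "q @ b" x] by simp
next
  case (drop_pair u p x q)
  then show ?case
    using cancel_eq.drop_pair[of "a @ u @ b" "a @ p" x "q @ b"] by simp
qed auto

lemma cancel_eq_append:
  assumes "u \<approx> u'" "v \<approx> v'"
  shows "u @ v \<approx> u' @ v'"
  using cancel_eq_context[OF assms(1), of "[]" v] cancel_eq_context[OF assms(2), of u' "[]"]
  by (auto intro: cancel_eq_trans)

lemma cancel_eq_rev:
  assumes "u \<approx> v"
  shows "rev u \<approx> rev v"
  using assms
proof induction
  case (add_pair u p q x)
  then show ?case
    using cancel_eq.add_pair[of "rev u" "rev q" "rev p" x] by simp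
next
  case (drop_pair u p x q)
  then show ?case
    using cancel_eq.drop_pair[of "rev u" "rev q" x "rev p"] by simp
qed auto

lemma cancel_eq_append_rev [simp]: "u @ rev u \<approx> []"
proof (induction u)
  case (Cons x u)
  have "x # u @ rev u @ [x] \<approx> [x, x]"
    using cancel_eq_context[OF Cons.IH, of "[x]" "[x]"] by simp
  also have "[x, x] \<approx> []"
    using cancel_eq.drop_pair[of "[x, x]" "[]" x "[]"] by simp
  finally show ?case by simp
qed auto

text \<open>\<open>catalan_word\<close> respects cancellation only at odd length, so parity is
  carried through the induction together with the value.\<close>

lemma cancel_eq_invariant:
  assumes "u \<approx> v"
    and "\<And>p q x. odd (length (p @ q)) \<Longrightarrow> f (p @ [x, x] @ q) = f (p @ q)"
  shows "(odd (length u) \<longleftrightarrow> odd (length v)) \<and> (odd (length u) \<longrightarrow> f u = f v)"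
  using assms(1)
proof induction
  case (add_pair u p q x)
  then show ?case using assms(2)[of p q x] by auto
next
  case (drop_pair u p x q)
  then show ?case using assms(2)[of p q x] by auto
qed auto

text \<open>Membership in the subgroup generated by \<open>S\<close> in the third power of that free
  product. Letters are their own inverses, so plain products of members of \<open>S\<close>
  suffice.\<close>

definition generates :: "'a list set \<Rightarrow> 'a list \<Rightarrow> 'a list \<Rightarrow> 'a list \<Rightarrow> bool" where
  "generates S u v w \<longleftrightarrow> (\<exists>ts. set ts \<subseteq> S \<and>
     map (\<lambda>t. t ! 0) ts \<approx> u \<and> map (\<lambda>t. t ! 1) ts \<approx> v \<and> map (\<lambda>t. t ! 2) ts \<approx> w)"

lemma generates_Nil [simp]: "generates S [] [] []"
  unfolding generates_def by (intro exI[of _ "[]"]) auto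

lemma generates_append:
  assumes "generates S u v w" "generates S u' v' w'"
  shows "generates S (u @ u') (v @ v') (w @ w')"
proof -
  from assms obtain ts ts' where
    "set ts \<subseteq> S" "map (\<lambda>t. t ! 0) ts \<approx> u" "map (\<lambda>t. t ! 1) ts \<approx> v" "map (\<lambda>t. t ! 2) ts \<approx> w"
    "set ts' \<subseteq> S" "map (\<lambda>t. t ! 0) ts' \<approx> u'" "map (\<lambda>t. t ! 1) ts' \<approx> v'" "map (\<lambda>t. t ! 2) ts' \<approx> w'"
    unfolding generates_def by blast
  then show ?thesis
    unfolding generates_def by (intro exI[of _ "ts @ ts'"]) (auto intro: cancel_eq_append)
qed

lemma generates_rev:
  assumes "generates S u v w"
  shows "generates S (rev u) (rev v) (rev w)"
proof -
  from assms obtain ts where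
    "set ts \<subseteq> S" "map (\<lambda>t. t ! 0) ts \<approx> u" "map (\<lambda>t. t ! 1) ts \<approx> v" "map (\<lambda>t. t ! 2) ts \<approx> w"
    unfolding generates_def by blast
  then show ?thesis
    unfolding generates_def
    by (intro exI[of _ "rev ts"]) (auto simp flip: rev_map intro: cancel_eq_rev)
qed

lemma generates_cong:
  assumes "generates S u v w" "u \<approx> u'" "v \<approx> v'" "w \<approx> w'"
  shows "generates S u' v' w'"
  using assms unfolding generates_def by (meson cancel_eq_trans)

lemma generates_map:
  assumes "\<And>k. k \<in> set ks \<Longrightarrow> [f k, g k, h k] \<in> S"
  shows "generates S (map f ks) (map g ks) (map h ks)"
  unfolding generates_def
  by (intro exI[of _ "map (\<lambda>k. [f k, g k, h k]) ks"]) (use assms in \<open>auto simp: comp_def\<close>)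

text \<open>A commutator dies in each coordinate in which one of its two factors is trivial.\<close>

lemma generates_commutator:
  assumes x: "generates S [] v x" and y: "generates S u [] y"
  shows "generates S [] [] (x @ y @ rev x @ rev y)"
proof -
  have "generates S ([] @ u @ rev [] @ rev u) (v @ [] @ rev v @ rev []) (x @ y @ rev x @ rev y)"
    by (intro generates_append generates_rev x y)
  then show ?thesis
    by (rule generates_cong) auto
qed

text \<open>The words \<open>w\<close> generated as \<open>([], [], w)\<close> are normal in the
  group of all generated third coordinates.\<close>

lemma generates_conjugate:
  assumes x: "generates S u v x" and y: "generates S [] [] y"
  shows "generates S [] [] (x @ y @ rev x)"
proof -
  have "generates S (u @ [] @ rev u) (v @ [] @ rev v) (x @ y @ rev x)"
    by (intro generates_append generates_rev x y)
  then show ?thesis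
    by (rule generates_cong) auto
qed

lemma cancel_eq_pair: "p @ [x, x] @ q \<approx> p @ q"
  by (rule cancel_eq.drop_pair) (rule cancel_eq.same)

lemma cancel_eq_middle: "p @ u @ rev u @ q \<approx> p @ q"
  using cancel_eq_context[OF cancel_eq_append_rev, of p u q] by simp

lemma map_upt_cancel:
  assumes "\<And>i. i < n \<Longrightarrow> f (a + 2 * i) = f (Suc (a + 2 * i))"
  shows "map f [a..<a + 2 * n] \<approx> []"
  using assms
proof (induction n)
  case (Suc n)
  have "map f [a..<a + 2 * Suc n] = map f [a..<a + 2 * n] @ [f (a + 2 * n), f (a + 2 * n)] @ []"
    using Suc.prems[of n] by simp
  also have "\<dots> \<approx> map f [a..<a + 2 * n] @ []"
    by (rule cancel_eq_pair)
  also have "map f [a..<a + 2 * n] @ [] \<approx> []"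
    using Suc by simp
  finally show ?case .
qed simp

text \<open>
  The closed walk through all edges but the missing one yields the third coordinate
  \<open>s c\<^sub>0 s\<close> with \<open>s = c\<^sub>1 \<dots> c\<^sub>m\<^sub>-\<^sub>1\<close>. Modulo words generated as \<open>([], [], w)\<close>, the pairs
  \<open>c\<^sub>i c\<^sub>i\<^sub>+\<^sub>1\<close> commute, because each arises both with trivial first and with trivial second
  coordinate (from opposite edges of the \<open>2m\<close>-cycle), and their product over a period is trivial.
\<close>

lemma generates_missing_edge:
  assumes S: "\<And>k. 1 \<le> k \<Longrightarrow> k < 2 * m \<Longrightarrow> [L k, R k, C k] \<in> S"
    and L: "\<And>k. even k \<Longrightarrow> Suc k < 2 * m \<Longrightarrow> L k = L (Suc k)"
    and R: "\<And>k. odd k \<Longrightarrow> Suc k < 2 * m \<Longrightarrow> R k = R (Suc k)"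
    and C: "\<And>k. k < m \<Longrightarrow> C (m + k) = C k"
    and "odd m"
  shows "generates S [L 1] [R (2 * m - 1)] [C 0]"
proof -
  have shift: "map C [m + i..<m + j] = map C [i..<j]" if "j \<le> m" for i j
    using that C by (intro nth_equalityI) (auto simp: add.assoc)
  have comm: "generates S [] [] (map C [1..<2 * k + 1] @ map C [0..<2 * k + 1] @ [C 0])"
    if "2 * k + 1 \<le> m" for k
    using that
  proof (induction k)
    case 0
    have "[] \<approx> [C 0, C 0]"
      using cancel_eq_sym[OF cancel_eq_pair[of "[]" "C 0" "[]"]] by simp
    then show ?case
      by (auto intro: generates_cong[OF generates_Nil])
  next
    case (Suc k)
    define a b x where "a = map C [1..<2 * k + 1]" and "b = map C [0..<2 * k + 1]"
      and "x = [C (2 * k + 1), C (2 * k + 2)]"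
    define y where "y = b @ [C (2 * k + 1)]"
    have "generates S (map L [1..<1 + 2 * k]) [] a"
      unfolding a_def
    proof (rule generates_cong[OF generates_map[of "[1..<1 + 2 * k]" L R C]])
      show "map R [1..<1 + 2 * k] \<approx> []"
        using Suc.prems by (intro map_upt_cancel R) auto
    qed (use Suc.prems in \<open>auto intro!: S\<close>)
    \<comment> \<open>\<open>x\<close> is read from the opposite tuples:
      \<open>m + 2 * k + 1\<close> is even, so here the first coordinate cancels.\<close>
    moreover have "generates S [] (map R [m + 2 * k + 1..<m + 2 * k + 1 + 2 * 1]) x"
    proof (rule generates_cong[OF generates_map[of "[m + 2 * k + 1..<m + 2 * k + 1 + 2 * 1]" L R C]])
      show "map L [m + 2 * k + 1..<m + 2 * k + 1 + 2 * 1] \<approx> []"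
        using Suc.prems \<open>odd m\<close> by (intro map_upt_cancel L) auto
      have "map C [m + 2 * k + 1..<m + 2 * k + 1 + 2 * 1] = x"
        using C[of "2 * k + 1"] C[of "2 * k + 2"] Suc.prems by (simp add: x_def)
      then show "map C [m + 2 * k + 1..<m + 2 * k + 1 + 2 * 1] \<approx> x"
        by simp
    qed (use Suc.prems in \<open>auto intro!: S\<close>)
    \<comment> \<open>Index \<open>0\<close> is the missing tuple, so \<open>y\<close>, which starts
      with \<open>C 0\<close>, is read from index \<open>m\<close> on.\<close>
    moreover have "generates S (map L [m..<m + 2 * (k + 1)]) [] y"
    proof (rule generates_cong[OF generates_map[of "[m..<m + 2 * (k + 1)]" L R C]])
      show "map R [m..<m + 2 * (k + 1)] \<approx> []"
        using Suc.prems \<open>odd m\<close> by (intro map_upt_cancel R) auto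
      have "map C [m..<m + 2 * (k + 1)] = y"
        using shift[of "2 * k + 2" 0] Suc.prems by (simp add: y_def b_def)
      then show "map C [m..<m + 2 * (k + 1)] \<approx> y"
        by simp
    qed (use Suc.prems \<open>odd m\<close> in \<open>auto intro!: S elim!: oddE\<close>)
    \<comment> \<open>Multiplied by the induction hypothesis \<open>a b c_0\<close>, this conjugated
      commutator gives \<open>a x b c_{2k+1} c_{2k+2} c_0\<close>, the word for
      \<open>Suc k\<close>, because \<open>y = b c_{2k+1}\<close>.\<close>
    ultimately have "generates S [] [] (a @ (x @ y @ rev x @ rev y) @ rev a)"
      by (blast intro: generates_conjugate generates_commutator)
    moreover have "generates S [] [] (a @ b @ [C 0])"
      using Suc by (simp add: a_def b_def)
    ultimately have "generates S ([] @ []) ([] @ [])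
        ((a @ (x @ y @ rev x @ rev y) @ rev a) @ (a @ b @ [C 0]))"
      by (rule generates_append)
    then have "generates S [] [] (a @ x @ b @ [C (2 * k + 1), C (2 * k + 2), C 0])"
    proof (rule generates_cong)
      show "(a @ (x @ y @ rev x @ rev y) @ rev a) @ (a @ b @ [C 0])
          \<approx> a @ x @ b @ [C (2 * k + 1), C (2 * k + 2), C 0]"
      proof -
        have "(a @ (x @ y @ rev x @ rev y) @ rev a) @ (a @ b @ [C 0])
            \<approx> (a @ (x @ y @ rev x @ rev y)) @ (b @ [C 0])"
          using cancel_eq_middle[of "a @ (x @ y @ rev x @ rev y)" "rev a" "b @ [C 0]"] by simp
        also have "\<dots> = (a @ x @ y @ [C (2 * k + 2)])
            @ [C (2 * k + 1), C (2 * k + 1)] @ (rev b @ b @ [C 0])"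
          by (simp add: x_def y_def)
        also have "\<dots> \<approx> (a @ x @ y @ [C (2 * k + 2)]) @ (rev b @ b @ [C 0])"
          by (rule cancel_eq_pair)
        also have "\<dots> \<approx> (a @ x @ y @ [C (2 * k + 2)]) @ [C 0]"
          using cancel_eq_middle[of "a @ x @ y @ [C (2 * k + 2)]" "rev b" "[C 0]"] by simp
        finally show ?thesis
          by (simp add: y_def)
      qed
    qed auto
    moreover have "a @ x @ b @ [C (2 * k + 1), C (2 * k + 2), C 0]
        = map C [1..<2 * Suc k + 1] @ map C [0..<2 * Suc k + 1] @ [C 0]"
      by (simp add: a_def b_def x_def upt_rec[of 0])
    ultimately show ?case
      by (simp only:)
  qed
  obtain k where k: "m = 2 * k + 1"
    using \<open>odd m\<close> by (auto elim: oddE)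
  define w where "w = map C [1..<m] @ map C [0..<m]"
  have "generates S [] [] (w @ [C 0])"
    using comm[of k] k by (simp add: w_def)
  then have "generates S [] [] (C 0 # rev w)"
    using generates_rev[of S "[]" "[]" "w @ [C 0]"] by simp
  moreover have "generates S [L 1] [R (2 * m - 1)] w"
  proof (rule generates_cong[OF generates_map[of "[1..<2 * m]" L R C]])
    have "map L [2..<2 + 2 * (m - 1)] \<approx> []"
      by (intro map_upt_cancel L) auto
    then have "[L 1] @ map L [2..<2 + 2 * (m - 1)] \<approx> [L 1] @ []"
      by (intro cancel_eq_append) auto
    moreover have "[1..<2 * m] = 1 # [2..<2 + 2 * (m - 1)]"
      using k upt_conv_Cons[of 1 "2 * m"] by (simp add: numeral_2_eq_2)
    ultimately show "map L [1..<2 * m] \<approx> [L 1]"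
      by simp
    have "map R [1..<1 + 2 * (m - 1)] \<approx> []"
      by (intro map_upt_cancel R) auto
    then have "map R [1..<1 + 2 * (m - 1)] @ [R (2 * m - 1)] \<approx> [] @ [R (2 * m - 1)]"
      by (intro cancel_eq_append) auto
    moreover have "map R [1..<2 * m] = map R [1..<1 + 2 * (m - 1)] @ [R (2 * m - 1)]"
      using k by simp
    ultimately show "map R [1..<2 * m] \<approx> [R (2 * m - 1)]"
      by simp
    have "map C [1..<2 * m] = map C [1..<m] @ map C [m + 0..<m + m]"
      using k upt_add_eq_append[of 1 m m] by (simp add: mult_2 flip: map_append)
    then show "map C [1..<2 * m] \<approx> w"
      using shift[of m 0] by (simp add: w_def)
  qed (auto intro: S)
  \<comment> \<open>The left factor turns the third coordinate \<open>w\<close> into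
    \<open>C 0\<close> and leaves the other two unchanged.\<close>
  ultimately have "generates S ([] @ [L 1]) ([] @ [R (2 * m - 1)]) ((C 0 # rev w) @ w)"
    by (rule generates_append)
  then show ?thesis
    using cancel_eq_middle[of "[C 0]" "rev w" "[]"] by (auto intro: generates_cong)
qed

text \<open>The cyclic order of the tuples; \<open>k = 0\<close> is the removed tuple.\<close>

lemma CYC_star_edge:
  assumes "odd m" "1 < m" "1 \<le> k" "k < 2 * m"
  shows "[int (k div 2), int (Suc k div 2) mod int m, (- int k) mod int m] \<in> CYC_star m"
proof -
  let ?a = "int (k div 2)" and ?b = "int (Suc k div 2)"
  have m: "int m > 0"
    using assms by simp
  have s: "?a + ?b = int k"
    by linarith
  have d: "?b - ?a = 0 \<or> ?b - ?a = 1"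
    by linarith
  have "(?a + ?b mod int m + (- int k) mod int m) mod int m = (?a + ?b + (- int k)) mod int m"
    by (metis mod_add_left_eq mod_add_right_eq)
  moreover have "(?b mod int m - ?a) mod int m = (?b - ?a) mod int m"
    by (simp add: mod_simps)
  moreover have "?a \<noteq> 0 \<or> ?b mod int m \<noteq> 0"
  proof (cases "k = 1")
    case True
    then show ?thesis using assms by auto
  qed (use assms in auto)
  ultimately show ?thesis
    using s d m assms unfolding CYC_star_def Zmod_def by auto
qed

lemma generates_CYC_star:
  assumes "odd m" "1 < m"
  shows "generates (CYC_star m) [0] [0] [0]"
proof -
  define L R C where "L k = int (k div 2)" and "R k = int (Suc k div 2) mod int m"
    and "C k = (- int k) mod int m" for k
  have "generates (CYC_star m) [L 1] [R (2 * m - 1)] [C 0]"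
  proof (rule generates_missing_edge)
    show "[L k, R k, C k] \<in> CYC_star m" if "1 \<le> k" "k < 2 * m" for k
      using CYC_star_edge[OF assms that] by (simp add: L_def R_def C_def)
    show "C (m + k) = C k" for k
      by (simp add: C_def mod_eq_dvd_iff)
  qed (use \<open>odd m\<close> in \<open>auto simp: L_def R_def\<close>)
  \<comment> \<open>Tuple \<open>1\<close> shares its first entry, and tuple
    \<open>2 * m - 1\<close> its second entry, with the removed tuple.\<close>
  moreover have "L 1 = 0" "C 0 = 0"
    by (auto simp: L_def C_def)
  moreover have "R (2 * m - 1) = 0"
    using assms by (auto simp: R_def elim!: oddE)
  ultimately show ?thesis by simp
qed

text \<open>Applying \<open>catalan_word\<close> componentwise to the images of the generating
  tuples stays in \<open>Q\<close> and collapses to the image of \<open>[a, b, c]\<close>. Its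
  entries come from \<open>D\<close>, so injectivity would put \<open>[a, b, c]\<close> into
  \<open>P\<close>.\<close>

lemma not_admits_maltsev_embedding:
  assumes gen: "generates P [a] [b] [c]" and "P \<subseteq> nlists 3 D" "[a, b, c] \<in> nlists 3 D"
    and "[a, b, c] \<notin> P"
  shows "\<not> admits_maltsev_embedding TYPE('e) D 3 P"
proof
  assume "admits_maltsev_embedding TYPE('e) D 3 P"
  then obtain E :: "'e set" and \<sigma> Q \<phi> where \<sigma>: "inj_on \<sigma> D" and Q: "Q \<subseteq> nlists 3 E"
    and QP: "Q \<inter> nlists 3 (\<sigma> ` D) = map \<sigma> ` P" and mal: "maltsev_on E \<phi>"
    and closed: "\<And>t u v. t \<in> Q \<Longrightarrow> u \<in> Q \<Longrightarrow> v \<in> Q \<Longrightarrow> componentwise3 \<phi> 3 t u v \<in> Q"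
    unfolding admits_maltsev_embedding_def by metis
  \<comment> \<open>\<open>\<phi>\<close> is Mal'tsev on \<open>E\<close> only; this extension obeys
    both identities on the whole type, so \<open>catalan_word_cancel\<close> applies.\<close>
  define \<psi> where "\<psi> x y z = (if x \<in> E \<and> y \<in> E \<and> z \<in> E then \<phi> x y z else if x = y then z else x)"
    for x y z
  have \<psi>: "\<psi> x x y = y" "\<psi> y x x = y" for x y
    using mal by (auto simp: \<psi>_def maltsev_on_def)
  have closed': "componentwise3 \<psi> 3 t u v \<in> Q" if "t \<in> Q" "u \<in> Q" "v \<in> Q" for t u v
  proof -
    have "componentwise3 \<psi> 3 t u v = componentwise3 \<phi> 3 t u v"
      using that nlistsE_nth_in[OF subsetD[OF Q]] by (simp add: componentwise3_def \<psi>_def)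
    with closed[OF that] show ?thesis by simp
  qed
  let ?f = "\<lambda>xs. catalan_word \<psi> (map \<sigma> xs)"
  obtain ts where ts: "set ts \<subseteq> P" "map (\<lambda>t. t ! 0) ts \<approx> [a]" "map (\<lambda>t. t ! 1) ts \<approx> [b]"
      "map (\<lambda>t. t ! 2) ts \<approx> [c]"
    using gen unfolding generates_def by blast
  have cancel: "?f (p @ [x, x] @ q) = ?f (p @ q)" if "odd (length (p @ q))" for p q x
    using catalan_word_cancel[of \<psi>, OF \<psi>, of "map \<sigma> p" "map \<sigma> q"] that by simp
  \<comment> \<open>The parity part is what allows \<open>catalan_word_closed\<close> to be applied
    to \<open>ts\<close>.\<close>
  have f: "odd (length xs) \<and> ?f xs = \<sigma> x" if "xs \<approx> [x]" for xs x
  proof -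
    have "?f [x] = \<sigma> x"
      by (simp add: catalan_word_def)
    with cancel_eq_invariant[OF that, of ?f, OF cancel] show ?thesis
      by simp
  qed
  have "map (\<lambda>i. catalan_word \<psi> (map (\<lambda>q. q ! i) (map (map \<sigma>) ts))) [0..<3] \<in> Q"
  proof (rule catalan_word_closed[OF closed'])
    show "set (map (map \<sigma>) ts) \<subseteq> Q"
      using ts QP by auto
    show "odd (length (map (map \<sigma>) ts))"
      using f[OF ts(2)] by simp
  qed (use Q in auto)
  moreover have "map (\<lambda>q. q ! i) (map (map \<sigma>) ts) = map \<sigma> (map (\<lambda>t. t ! i) ts)" if "i < 3" for i
  proof -
    have "length t = 3" if "t \<in> set ts" for t
      using that ts(1) assms(2) nlistsE_length by blast
    with that show ?thesis by simp
  qed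
  moreover have "[0..<3] = [0, 1, 2]"
    by (simp add: upt_rec)
  ultimately have "[?f (map (\<lambda>t. t ! 0) ts), ?f (map (\<lambda>t. t ! 1) ts), ?f (map (\<lambda>t. t ! 2) ts)] \<in> Q"
    by (simp del: map_map)
  then have "[\<sigma> a, \<sigma> b, \<sigma> c] \<in> Q"
    by (simp only: f[OF ts(2)] f[OF ts(3)] f[OF ts(4)])
  moreover have "[\<sigma> a, \<sigma> b, \<sigma> c] \<in> nlists 3 (\<sigma> ` D)"
    using nlistsE_set[OF assms(3)] by (intro nlistsI) auto
  ultimately have "[\<sigma> a, \<sigma> b, \<sigma> c] \<in> map \<sigma> ` P"
    by (metis IntI QP)
  then obtain p where p: "[\<sigma> a, \<sigma> b, \<sigma> c] = map \<sigma> p" "p \<in> P"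
    by (rule imageE)
  have "set p \<union> set [a, b, c] \<subseteq> D"
    using nlistsE_set[OF assms(3)] nlistsE_set[OF subsetD[OF assms(2) p(2)]] by simp
  moreover have "map \<sigma> p = map \<sigma> [a, b, c]"
    by (simp flip: p(1))
  ultimately have "p = [a, b, c]"
    by (metis map_inj_on inj_on_subset \<sigma>)
  with p assms(4) show False by simp
qed

section \<open>The Moore bound\<close>

text \<open>
  Girth greater than \<open>l\<close>, stated without mentioning cycles: every walk joining the ends of an
  edge without using that edge has at least \<open>l\<close> steps.
\<close>

definition long_detours :: "nat \<Rightarrow> 'a set set \<Rightarrow> bool" where
  "long_detours l E \<longleftrightarrow>
     (\<forall>u v p. {u, v} \<in> E \<longrightarrow> p \<noteq> [] \<longrightarrow> hd p = u \<longrightarrow> last p = v \<longrightarrow>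
        successively (\<lambda>a b. {a, b} \<in> E - {{u, v}}) p \<longrightarrow> l < length p)"

lemma long_detoursD:
  assumes "long_detours l E" "{u, v} \<in> E" "p \<noteq> []" "hd p = u" "last p = v"
    "successively (\<lambda>a b. {a, b} \<in> E - {{u, v}}) p"
  shows "l < length p"
  using assms unfolding long_detours_def by blast

lemma long_detours_mono:
  assumes "long_detours l E" "F \<subseteq> E"
  shows "long_detours l F"
  unfolding long_detours_def
proof (intro allI impI)
  fix u v p
  assume p: "{u, v} \<in> F" "p \<noteq> []" "hd p = u" "last p = v"
    and s: "successively (\<lambda>a b. {a, b} \<in> F - {{u, v}}) p"
  have "successively (\<lambda>a b. {a, b} \<in> E - {{u, v}}) p"
    using assms(2) by (intro successively_mono[OF s]) auto
  with p show "l < length p"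
    using assms by (intro long_detoursD[OF assms(1), of u v]) auto
qed

text \<open>Paths grow at the head; the root \<open>r\<close> is the last vertex.\<close>

definition path_from :: "'a set set \<Rightarrow> 'a \<Rightarrow> 'a list \<Rightarrow> bool" where
  "path_from E r p \<longleftrightarrow>
     p \<noteq> [] \<and> distinct p \<and> last p = r \<and> successively (\<lambda>a b. {a, b} \<in> E) p"

lemma path_from_Cons_Cons:
  "path_from E r (x # y # p) \<longleftrightarrow> {x, y} \<in> E \<and> x \<notin> set (y # p) \<and> path_from E r (y # p)"
  unfolding path_from_def by auto

lemma successively_avoid:
  assumes "successively (\<lambda>a b. {a, b} \<in> E) p" "z \<notin> set p"
  shows "successively (\<lambda>a b. {a, b} \<in> E - {{x, z}}) p"
  using assms by (intro successively_mono[OF assms(1)]) (auto simp: doubleton_eq_iff)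

text \<open>Otherwise the piece of the path from its head to \<open>w\<close> is a detour around the
  edge \<open>{w, hd p}\<close> with at most \<open>l\<close> vertices.\<close>

lemma path_from_neighbour:
  assumes ld: "long_detours l E" and p: "path_from E r p" "length p \<le> l"
    and w: "w \<in> set p" "{w, hd p} \<in> E" "w \<noteq> hd p"
  shows "w = p ! 1"
proof (rule ccontr)
  assume ne: "w \<noteq> p ! 1"
  obtain x p' where px: "p = x # p'"
    using p unfolding path_from_def by (cases p) auto
  with w obtain a b where ab: "p' = a @ w # b"
    by (auto dest: split_list)
  have "a \<noteq> []"
    using ne px ab by auto
  have s: "successively (\<lambda>a b. {a, b} \<in> E) (x # a @ [w])" and d: "distinct (x # a @ [w])"
    using p px ab \<open>a \<noteq> []\<close> unfolding path_from_def
    by (auto simp: successively_append_iff successively_Cons)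
  \<comment> \<open>\<open>x # a\<close> avoids \<open>w\<close> and \<open>a @ [w]\<close> avoids
    \<open>x\<close>; each step lies in one of the two, so none uses \<open>{x, w}\<close>.\<close>
  have s1: "successively (\<lambda>a b. {a, b} \<in> E - {{x, w}}) (x # a)"
    using s d \<open>a \<noteq> []\<close> by (intro successively_avoid) (auto simp: successively_Cons successively_append_iff)
  have s2: "successively (\<lambda>a b. {a, b} \<in> E - {{w, x}}) (a @ [w])"
    using s d by (intro successively_avoid) (auto simp: successively_Cons successively_append_iff)
  have "successively (\<lambda>a b. {a, b} \<in> E - {{x, w}}) (x # a @ [w])"
    using s1 s2 \<open>a \<noteq> []\<close> by (auto simp: successively_Cons successively_append_iff insert_commute)
  then have "l < length (x # a @ [w])"
    using w px by (intro long_detoursD[OF ld, of x w]) (auto simp: insert_commute)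
  with p px ab show False by auto
qed

text \<open>Strip the common head. If the next vertices differ, going to the root along one path and
  back along the other is too short a detour; it may repeat vertices, which
  \<open>long_detours\<close> permits.\<close>

lemma path_from_unique:
  assumes ld: "long_detours (2 * k) E"
    and "path_from E r p" "path_from E r q" "hd p = hd q" "length p = length q"
    and "length p \<le> Suc k"
  shows "p = q"
  using assms(2-)
proof (induction p arbitrary: q)
  case Nil
  then show ?case by auto
next
  case (Cons w p)
  then obtain q' where q: "q = w # q'"
    by (cases q) auto
  show ?case
  proof (cases p)
    case Nil
    with Cons.prems q show ?thesis by auto
  next
    case p: (Cons x p')
    then obtain y q'' where q': "q' = y # q''"
      using Cons.prems q by (cases q') auto
    have P: "{w, x} \<in> E" "w \<notin> set p" "path_from E r p"
      using Cons.prems p by (auto simp: path_from_Cons_Cons)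
    have Q: "{w, y} \<in> E" "w \<notin> set q'" "path_from E r q'"
      using Cons.prems q q' by (auto simp: path_from_Cons_Cons)
    have "x = y"
    proof (rule ccontr)
      assume "x \<noteq> y"
      let ?S = "successively (\<lambda>a b. {a, b} \<in> E - {{x, w}})"
      \<comment> \<open>From \<open>x\<close> along \<open>p\<close> to the root, then back to
        \<open>w\<close>; \<open>tl\<close> drops the second copy of the root, so there are
        \<open>length p + length q'\<close> vertices, at most \<open>2 * k\<close>.\<close>
      define c where "c = p @ tl (rev q' @ [w])"
      have lastp: "last p = r" and lastq: "last q' = r" and "q' \<noteq> []"
        using P Q unfolding path_from_def by auto
      have sp: "?S p"
        using P by (intro successively_avoid) (auto simp: path_from_def)
      have "?S q'"
        using Q by (intro successively_avoid) (auto simp: path_from_def)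
      then have "?S (w # q')"
        using Q \<open>x \<noteq> y\<close> q' by (auto simp: successively_Cons doubleton_eq_iff)
      then have "?S (rev (w # q'))"
        by (subst successively_rev) (simp add: insert_commute)
      moreover have "rev (w # q') = r # tl (rev q' @ [w])"
        using lastq \<open>q' \<noteq> []\<close> by (cases q' rule: rev_cases) auto
      ultimately have sq: "?S (r # tl (rev q' @ [w]))"
        by simp
      have "?S c"
        using sp sq lastp unfolding c_def by (auto simp: successively_append_iff successively_Cons)
      moreover have "hd c = x" "c \<noteq> []" "last c = w"
        using p \<open>q' \<noteq> []\<close> unfolding c_def by (auto simp: last_tl tl_append split: list.splits)
      ultimately have "2 * k < length c"
        using P by (intro long_detoursD[OF ld, of x w]) (auto simp: insert_commute)
      then show False
        using Cons.prems q unfolding c_def by auto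
    qed
    with Cons.IH[of q'] Cons.prems P Q p q q' show ?thesis by auto
  qed
qed

text \<open>More than \<open>d\<close> edges meet the head of a path and at most one of them leads
  back onto the path, so every path has at least \<open>d\<close> extensions.\<close>

lemma card_paths_from:
  assumes fin: "finite V" and EV: "\<And>e. e \<in> E \<Longrightarrow> e \<subseteq> V \<and> card e = 2"
    and ld: "long_detours (2 * k) E" and deg: "\<And>v. v \<in> V \<Longrightarrow> d < card {e \<in> E. v \<in> e}"
    and "r \<in> V" "i \<le> k"
  shows "d ^ i \<le> card {p. path_from E r p \<and> length p = Suc i \<and> set p \<subseteq> V}"
  using \<open>i \<le> k\<close>
proof (induction i)
  case 0
  have "{p. path_from E r p \<and> length p = Suc 0 \<and> set p \<subseteq> V} = {[r]}"
    using \<open>r \<in> V\<close> by (auto simp: path_from_def length_Suc_conv)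
  then show ?case by simp
next
  case (Suc i)
  define P where "P j = {p. path_from E r p \<and> length p = Suc j \<and> set p \<subseteq> V}" for j
  define N where "N p = {w. {w, hd p} \<in> E \<and> w \<notin> set p}" for p
  have finP: "finite (P j)" for j
    by (rule finite_subset[OF _ finite_lists_length_eq[OF fin, of "Suc j"]]) (auto simp: P_def)
  have finN: "finite (N p)" for p
    by (rule finite_subset[OF _ fin]) (use EV in \<open>auto simp: N_def\<close>)
  have N: "d \<le> card (N p)" if p: "p \<in> P i" for p
  proof -
    have pp: "path_from E r p" "length p = Suc i" "set p \<subseteq> V" "hd p \<in> V"
      using p by (auto simp: P_def path_from_def)
    \<comment> \<open>For a one-vertex path \<open>p ! 1\<close> is unspecified; inserting it only
      enlarges the right-hand side.\<close>
    have "{e \<in> E. hd p \<in> e} \<subseteq> (\<lambda>w. {w, hd p}) ` insert (p ! 1) (N p)"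
    proof
      fix e assume e: "e \<in> {e \<in> E. hd p \<in> e}"
      with EV[of e] obtain w where w: "e = {w, hd p}" "w \<noteq> hd p"
        by (auto simp: card_2_iff)
      have "w \<in> N p" if "w \<noteq> p ! 1"
        using path_from_neighbour[OF ld pp(1), of w] pp(2) Suc.prems that w e
        by (auto simp: N_def)
      with w show "e \<in> (\<lambda>w. {w, hd p}) ` insert (p ! 1) (N p)"
        by blast
    qed
    then have "card {e \<in> E. hd p \<in> e} \<le> card (insert (p ! 1) (N p))"
      by (meson card_image_le card_mono finN finite.insertI finite_imageI le_trans)
    also have "\<dots> \<le> Suc (card (N p))"
      by (rule card_insert_le_m1) auto
    finally show ?thesis
      using deg[OF pp(4)] by simp
  qed
  have "d ^ Suc i \<le> d * card (P i)"
    using Suc by (simp add: P_def)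
  also have "\<dots> \<le> (\<Sum>p\<in>P i. card (N p))"
    using sum_mono[of "P i" "\<lambda>_. d", OF N] by (simp add: mult.commute)
  also have "\<dots> = card (SIGMA p:P i. N p)"
    using finP finN by simp
  also have "\<dots> = card ((\<lambda>(p, w). w # p) ` (SIGMA p:P i. N p))"
    by (rule card_image[symmetric]) (auto simp: inj_on_def)
  also have "\<dots> \<le> card (P (Suc i))"
  proof (rule card_mono[OF finP], clarsimp)
    fix p w assume "p \<in> P i" "w \<in> N p"
    then show "w # p \<in> P (Suc i)"
      using EV by (cases p) (auto simp: P_def N_def path_from_Cons_Cons)
  qed
  finally show ?case
    by (simp add: P_def)
qed

text \<open>Delete vertices of degree at most \<open>d\<close> one by one. If none is left to
  delete, the at least \<open>d ^ k\<close> paths with \<open>k\<close> steps from a root end in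
  distinct vertices, too many for \<open>V\<close>.\<close>

lemma moore_bound:
  assumes "finite V" and "\<And>e. e \<in> E \<Longrightarrow> e \<subseteq> V \<and> card e = 2"
    and "long_detours (2 * k) E" and "card V < d ^ k"
  shows "card E \<le> d * card V"
  using assms
proof (induction "card V" arbitrary: V E)
  case 0
  then have "E = {}" by force
  then show ?case by simp
next
  case (Suc n)
  note EV = \<open>\<And>e. e \<in> E \<Longrightarrow> e \<subseteq> V \<and> card e = 2\<close>
  note ld = \<open>long_detours (2 * k) E\<close>
  show ?case
  proof (cases "\<exists>v\<in>V. card {e \<in> E. v \<in> e} \<le> d")
    case True
    then obtain v where v: "v \<in> V" "card {e \<in> E. v \<in> e} \<le> d"
      by blast
    have "finite E"
      by (rule finite_subset[of _ "Pow V"]) (use EV \<open>finite V\<close> in auto)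
    have V': "n = card (V - {v})" "card (V - {v}) < card V"
      using Suc.hyps v Suc.prems by auto
    have "card {e \<in> E. v \<notin> e} \<le> d * card (V - {v})"
    proof (rule Suc.hyps(1)[OF V'(1)])
      show "long_detours (2 * k) {e \<in> E. v \<notin> e}"
        by (rule long_detours_mono[OF ld]) auto
    qed (use Suc.prems V' EV in auto)
    moreover have "card E = card {e \<in> E. v \<in> e} + card {e \<in> E. v \<notin> e}"
      using \<open>finite E\<close> by (subst card_Un_disjoint[symmetric]) (auto intro!: arg_cong[of _ _ card])
    moreover have "card V = Suc (card (V - {v}))"
      using V' Suc.hyps(2) by simp
    ultimately show ?thesis
      using v by (metis add_mono mult_Suc_right)
  next
    case False
    obtain r where r: "r \<in> V"
      using Suc.hyps(2) by force
    let ?P = "{p. path_from E r p \<and> length p = Suc k \<and> set p \<subseteq> V}"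
    have "d ^ k \<le> card ?P"
      using False by (intro card_paths_from[OF \<open>finite V\<close> EV ld _ r]) auto
    also have "\<dots> = card (hd ` ?P)"
      using path_from_unique[OF ld]
      by (intro card_image[symmetric] inj_onI) auto
    also have "\<dots> \<le> card V"
      by (rule card_mono[OF \<open>finite V\<close>]) (auto simp: path_from_def intro!: subsetD[OF _ hd_in_set])
    finally show ?thesis
      using Suc.prems by simp
  qed
qed

section \<open>Linear constraints\<close>

lemma sum_fun_apply: "(\<Sum>a\<in>A. f a) x = (\<Sum>a\<in>A. f a x)"
  by (induction A rule: infinite_finite_induct) auto

text \<open>The pairing matrix is diagonal with nonzero diagonal, so the \<open>f y\<close>,
  restricted to \<open>I\<close>, are independent in a space of dimension
  \<open>card I\<close>.\<close>

lemma dual_system_card_le: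
  fixes f g :: "'y \<Rightarrow> 'i \<Rightarrow> 'k::field"
  assumes "finite I"
    and dual: "\<And>y z. y \<in> Y \<Longrightarrow> z \<in> Y \<Longrightarrow> (\<Sum>i\<in>I. f y i * g z i) = 0 \<longleftrightarrow> y \<noteq> z"
  shows "card Y \<le> card I"
proof -
  interpret vector_space "\<lambda>(c::'k) (h::'i \<Rightarrow> 'k) i. c * h i"
    by unfold_locales (auto simp: fun_eq_iff algebra_simps)
  define F where "F y i = (if i \<in> I then f y i else 0)" for y i
  define e :: "'i \<Rightarrow> 'i \<Rightarrow> 'k" where "e j i = (if i = j then 1 else 0)" for j i
  define pair where "pair h z = (\<Sum>i\<in>I. h i * g z i)" for h z
  have pair: "pair (F y) z = 0 \<longleftrightarrow> y \<noteq> z" if "y \<in> Y" "z \<in> Y" for y z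
  proof -
    have "pair (F y) z = (\<Sum>i\<in>I. f y i * g z i)"
      unfolding pair_def F_def by (intro sum.cong) auto
    with dual[OF that] show ?thesis by simp
  qed
  have inj: "inj_on F Y"
    by (rule inj_onI) (metis pair)
  have "independent (F ` Y)"
    unfolding independent_explicit_finite_subsets
  proof (intro allI impI ballI)
    fix T u v
    assume T: "T \<subseteq> F ` Y" "finite T" and 0: "(\<Sum>v\<in>T. (\<lambda>i. u v * v i)) = 0" and v: "v \<in> T"
    then obtain z where z: "z \<in> Y" "v = F z" by blast
    \<comment> \<open>Pairing the linear relation with \<open>g z\<close> annihilates every term
      except that of \<open>v\<close>.\<close>
    have "0 = pair (\<Sum>v\<in>T. (\<lambda>i. u v * v i)) z"
      by (simp add: 0 pair_def)
    also have "\<dots> = (\<Sum>i\<in>I. \<Sum>w\<in>T. u w * w i * g z i)"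
      by (simp add: pair_def sum_fun_apply sum_distrib_right)
    also have "\<dots> = (\<Sum>w\<in>T. u w * pair w z)"
      by (subst sum.swap) (simp add: pair_def sum_distrib_left mult.assoc)
    also have "\<dots> = (\<Sum>w\<in>T. if w = v then u v * pair v z else 0)"
      using T z pair by (intro sum.cong) auto
    also have "\<dots> = u v * pair v z"
      using T v by simp
    finally show "u v = 0"
      using pair[OF z(1) z(1)] z by simp
  qed
  moreover have "F ` Y \<subseteq> span (e ` I)"
  proof clarify
    fix y
    have "F y = (\<Sum>j\<in>I. (\<lambda>i. f y j * e j i))"
      using \<open>finite I\<close> by (auto simp: fun_eq_iff F_def e_def sum_fun_apply if_distrib cong: if_cong)
    also have "\<dots> \<in> span (e ` I)"
      by (intro span_sum span_scale span_base) auto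
    finally show "F y \<in> span (e ` I)" .
  qed
  ultimately have "card (F ` Y) \<le> card (e ` I)"
    using independent_span_bound[of "e ` I" "F ` Y"] \<open>finite I\<close> by simp
  also have "\<dots> \<le> card I"
    using \<open>finite I\<close> by (rule card_image_le)
  finally show ?thesis
    by (simp add: card_image[OF inj])
qed

section \<open>Roots of unity and sums of two points of the unit circle\<close>

definition unity_root :: "nat \<Rightarrow> int \<Rightarrow> complex" where
  "unity_root m t = cis (2 * pi * of_int t / of_nat m)"

lemma unity_root_add: "unity_root m (s + t) = unity_root m s * unity_root m t"
  by (simp add: unity_root_def cis_mult ring_distribs add_divide_distrib)

lemma unity_root_cnj: "cnj (unity_root m t) * unity_root m t = 1"
  by (simp add: unity_root_def cis_cnj cis_mult)

lemma cis_eq_1_iff: "cis x = 1 \<longleftrightarrow> (\<exists>k::int. x = of_int k * (2 * pi))"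
proof -
  have "sin x = 0" if "cos x = 1"
    using sin_cos_squared_add[of x] that by simp
  then show ?thesis
    by (auto simp: complex_eq_iff cos_one_2pi_int mult.assoc)
qed

lemma unity_root_eq_1_iff:
  assumes "m > 0"
  shows "unity_root m t = 1 \<longleftrightarrow> int m dvd t"
proof -
  have "(2 * pi * of_int t / of_nat m = of_int k * (2 * pi)) \<longleftrightarrow> t = int m * k" for k
  proof -
    have "(2 * pi * of_int t / of_nat m = of_int k * (2 * pi)) \<longleftrightarrow> of_int t = (of_int (int m * k) :: real)"
      using assms by (simp add: field_simps)
    then show ?thesis
      by (simp only: of_int_eq_iff)
  qed
  then show ?thesis
    by (auto simp: unity_root_def cis_eq_1_iff dvd_def)
qed

lemma unity_root_eq_iff:
  assumes "m > 0"
  shows "unity_root m s = unity_root m t \<longleftrightarrow> int m dvd s - t"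
proof -
  have "unity_root m s = unity_root m (s - t) * unity_root m t"
    by (simp flip: unity_root_add)
  moreover have "unity_root m t \<noteq> 0"
    by (simp add: unity_root_def)
  ultimately show ?thesis
    by (simp flip: unity_root_eq_1_iff[OF assms])
qed

text \<open>On the unit circle \<open>cnj (x + y) * (x * y) = x + y\<close>, so a nonzero sum
  determines the product, and then the pair as the roots of a quadratic.\<close>

lemma unit_sum_eq:
  fixes p q r s :: complex
  assumes "cnj p * p = 1" "cnj q * q = 1" "cnj r * r = 1" "cnj s * s = 1"
    and sum: "p + q = r + s" and "r + s \<noteq> 0"
  shows "p = r \<and> q = s \<or> p = s \<and> q = r"
proof -
  have mult_cnj: "cnj (x + y) * (x * y) = x + y" if "cnj x * x = 1" "cnj y * y = 1" for x y :: complex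
  proof -
    have "cnj (x + y) * (x * y) = (cnj x * x) * y + (cnj y * y) * x"
      by (simp add: algebra_simps)
    with that show ?thesis by (simp add: add.commute)
  qed
  have "cnj (r + s) * (p * q) = cnj (r + s) * (r * s)"
    using mult_cnj[OF assms(1,2)] mult_cnj[OF assms(3,4)] sum by simp
  then have "p * q = r * s"
    using \<open>r + s \<noteq> 0\<close> by (metis complex_cnj_zero_iff mult_left_cancel)
  then have "(p - r) * (p - s) = 0"
    using sum by algebra
  then show ?thesis
    using sum by auto
qed

text \<open>
  The tuples of the full cycle are the sides of a regular \<open>2m\<close>-gon in the complex plane: the first
  two entries determine the ends of a side, the third one its direction.
\<close>

lemma unity_root_equation:
  assumes "odd m"
  shows "unity_root m (2 * a + 1) + unity_root m (2 * b) - (unity_root m (- c) + unity_root m (1 - c)) = 0 \<longleftrightarrow>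
    (a + b + c) mod int m = 0 \<and> (b - a) mod int m \<in> {0, 1 mod int m}"
proof -
  have "m > 0"
    using assms by (auto intro: Nat.gr0I)
  note eq = unity_root_eq_iff[OF \<open>m > 0\<close>]
  have dbl: "int m dvd 2 * t \<longleftrightarrow> int m dvd t" for t
    using assms by (simp add: coprime_dvd_mult_right_iff)
  \<comment> \<open>A zero sum would mean \<open>unity_root m 1 = -1\<close>, impossible for a root
    of unity of odd order.\<close>
  have nz: "unity_root m (- c) + unity_root m (1 - c) \<noteq> 0"
  proof
    assume "unity_root m (- c) + unity_root m (1 - c) = 0"
    then have "unity_root m (- c) * unity_root m (- c) = unity_root m (1 - c) * unity_root m (1 - c)"
      by algebra
    then have "int m dvd 2 * 1"
      by (simp add: eq flip: unity_root_add)
    then have "unity_root m 1 = 1"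
      by (simp only: dbl unity_root_eq_1_iff[OF \<open>m > 0\<close>])
    then show False
      using \<open>unity_root m (- c) + unity_root m (1 - c) = 0\<close> unity_root_add[of m 1 "- c"]
      by (simp add: unity_root_def)
  qed
  have "unity_root m (2 * a + 1) + unity_root m (2 * b) - (unity_root m (- c) + unity_root m (1 - c)) = 0 \<longleftrightarrow>
      unity_root m (2 * a + 1) = unity_root m (- c) \<and> unity_root m (2 * b) = unity_root m (1 - c) \<or>
      unity_root m (2 * a + 1) = unity_root m (1 - c) \<and> unity_root m (2 * b) = unity_root m (- c)"
    using unit_sum_eq[OF unity_root_cnj unity_root_cnj unity_root_cnj unity_root_cnj _ nz] by auto
  \<comment> \<open>The two matchings of the points become the cases \<open>b - a = 1\<close> and
    \<open>b - a = 0\<close>; halving the congruences uses that \<open>m\<close> is odd.\<close>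
  also have "\<dots> \<longleftrightarrow> int m dvd 2 * a + c + 1 \<and> int m dvd 2 * b + c - 1 \<or>
      int m dvd 2 * a + c \<and> int m dvd 2 * b + c"
    by (simp add: eq algebra_simps)
  also have "int m dvd 2 * a + c + 1 \<and> int m dvd 2 * b + c - 1 \<longleftrightarrow>
      int m dvd a + b + c \<and> int m dvd b - a - 1"
  proof
    assume *: "int m dvd 2 * a + c + 1 \<and> int m dvd 2 * b + c - 1"
    have "int m dvd 2 * (b - a - 1)"
      using dvd_diff[of "int m" "2 * b + c - 1" "2 * a + c + 1"] * by (simp add: algebra_simps)
    moreover have "int m dvd 2 * (a + b + c)"
      using dvd_add[of "int m" "2 * a + c + 1" "2 * b + c - 1"] * by (simp add: algebra_simps)
    ultimately show "int m dvd a + b + c \<and> int m dvd b - a - 1"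
      by (simp only: dbl)
  next
    assume *: "int m dvd a + b + c \<and> int m dvd b - a - 1"
    show "int m dvd 2 * a + c + 1 \<and> int m dvd 2 * b + c - 1"
      using dvd_diff[of "int m" "a + b + c" "b - a - 1"] dvd_add[of "int m" "a + b + c" "b - a - 1"] *
      by (simp add: algebra_simps)
  qed
  also have "int m dvd 2 * a + c \<and> int m dvd 2 * b + c \<longleftrightarrow>
      int m dvd a + b + c \<and> int m dvd b - a"
  proof
    assume *: "int m dvd 2 * a + c \<and> int m dvd 2 * b + c"
    have 1: "int m dvd 2 * (b - a)"
      using dvd_diff[of "int m" "2 * b + c" "2 * a + c"] * by (simp add: algebra_simps)
    then have "int m dvd b - a"
      by (simp only: dbl)
    with * have "int m dvd (2 * a + c) + (b - a)"
      by (metis dvd_add)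
    moreover have "(2 * a + c) + (b - a) = a + b + c"
      by simp
    ultimately show "int m dvd a + b + c \<and> int m dvd b - a"
      using \<open>int m dvd b - a\<close> by simp
  next
    assume *: "int m dvd a + b + c \<and> int m dvd b - a"
    show "int m dvd 2 * a + c \<and> int m dvd 2 * b + c"
    proof -
      have "2 * a + c = (a + b + c) - (b - a)" "2 * b + c = (a + b + c) + (b - a)"
        by simp_all
      with * show ?thesis
        by (metis dvd_add dvd_diff)
    qed
  qed
  also have "(int m dvd a + b + c \<and> int m dvd b - a - 1 \<or> int m dvd a + b + c \<and> int m dvd b - a) \<longleftrightarrow>
      (a + b + c) mod int m = 0 \<and> (b - a) mod int m \<in> {0, 1 mod int m}"
    unfolding insert_iff empty_iff dvd_eq_mod_eq_0[symmetric] mod_eq_dvd_iff[of "b - a" "int m" 1]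
    by blast
  finally show ?thesis .
qed

section \<open>Non-redundant instances\<close>

lemma abs_walk_le:
  fixes f :: "'a \<Rightarrow> int"
  assumes "successively (\<lambda>u v. \<bar>f u - f v\<bar> \<le> 1) p" "p \<noteq> []"
  shows "\<bar>f (last p) - f (hd p)\<bar> < int (length p)"
  using assms
proof (induction p)
  case (Cons x p)
  then show ?case
    by (cases p) (auto simp: successively_Cons)
qed simp

lemma CYC_star_iff:
  "[a, b, c] \<in> CYC_star m \<longleftrightarrow> a \<in> Zmod m \<and> b \<in> Zmod m \<and> c \<in> Zmod m \<and>
     (a + b + c) mod int m = 0 \<and> (b - a) mod int m \<in> {0, 1} \<and> [a, b, c] \<noteq> [0, 0, 0]"
  unfolding CYC_star_def by auto

text \<open>
  The pairs of first and second entries in \<^const>\<open>CYC_star\<close> form the \<open>2m\<close>-cycle without the edge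
  \<open>(0, 0)\<close>, a path from \<open>Inl 0\<close> to \<open>Inr 0\<close>; this is the position along that path.
\<close>

definition path_pos :: "nat \<Rightarrow> ('v \<Rightarrow> int) \<Rightarrow> 'v + 'v \<Rightarrow> int" where
  "path_pos m s v = (case v of Inl x \<Rightarrow> 2 * s x
     | Inr x \<Rightarrow> if s x = 0 then 2 * int m - 1 else 2 * s x - 1)"

lemma path_pos_edge:
  assumes "[s x, s y, c] \<in> CYC_star m"
  shows "\<bar>path_pos m s (Inl x) - path_pos m s (Inr y)\<bar> \<le> 1"
proof -
  let ?a = "s x" and ?b = "s y"
  have ab: "0 \<le> ?a" "?a < int m" "0 \<le> ?b" "?b < int m" "0 \<le> c" "c < int m"
    and sum: "(?a + ?b + c) mod int m = 0" and diff: "(?b - ?a) mod int m \<in> {0, 1}"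
    and nz: "[?a, ?b, c] \<noteq> [0, 0, 0]"
    using assms by (auto simp: CYC_star_iff Zmod_def)
  have "(?b - ?a) mod int m = (if ?a \<le> ?b then ?b - ?a else ?b - ?a + int m)"
  proof (cases "?a \<le> ?b")
    case False
    have "(?b - ?a) mod int m = (?b - ?a + int m) mod int m"
      by simp
    also have "\<dots> = ?b - ?a + int m"
      using ab False by (intro mod_pos_pos_trivial) auto
    finally show ?thesis
      using False by simp
  qed (use ab in auto)
  \<comment> \<open>Both being zero would force \<open>c = 0\<close>, the removed tuple; this is the
    one edge along which the position would jump.\<close>
  moreover have "\<not> (?a = 0 \<and> ?b = 0)"
    using sum nz mod_pos_pos_trivial[OF ab(5,6)] by auto
  ultimately show ?thesis
    using diff ab by (auto simp: path_pos_def split: if_splits)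
qed

lemma card_nonredundant_le:
  fixes X :: "'v set"
  assumes m: "m \<ge> 3" "odd m" and inst: "csp_instance 3 X Y"
    and nonred: "nonredundant (Zmod m) (CYC_star m) X Y" and d: "2 * card X < d ^ (m - 1)"
  shows "card Y \<le> 3 * card X + d * (2 * card X)"
proof -
  have "finite X" and YX: "Y \<subseteq> nlists 3 X"
    using inst by (auto simp: csp_instance_def)
  have "finite Y"
    by (rule finite_subset[OF _ finite_lists_length_eq[OF \<open>finite X\<close>, of 3]])
      (use YX nlistsE_length nlistsE_set in blast)
  have Y: "y = [y ! 0, y ! 1, y ! 2]" "y ! 0 \<in> X" "y ! 1 \<in> X" "y ! 2 \<in> X" if "y \<in> Y" for y
    using subsetD[OF YX that] by (auto simp: numeral_3_eq_3 in_nlists_Suc_iff)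
  have map_Y: "map h y = [h (y ! 0), h (y ! 1), h (y ! 2)]" if "y \<in> Y" for h :: "'v \<Rightarrow> int" and y
    using arg_cong[OF Y(1)[OF that], of "map h"] by simp
  from nonred obtain s where s: "\<And>y. y \<in> Y \<Longrightarrow> s y \<in> X \<rightarrow> Zmod m"
      "\<And>y z. y \<in> Y \<Longrightarrow> z \<in> Y \<Longrightarrow> z \<noteq> y \<Longrightarrow> map (s y) z \<in> CYC_star m"
      "\<And>y. y \<in> Y \<Longrightarrow> map (s y) y \<notin> CYC_star m"
    unfolding nonredundant_def satisfies_def by (metis DiffI empty_iff insert_iff)
  have sat: "[s y (z ! 0), s y (z ! 1), s y (z ! 2)] \<in> CYC_star m"
    if "y \<in> Y" "z \<in> Y" "z \<noteq> y" for y z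
    using s(2)[OF that] by (simp add: map_Y[OF that(2)])
  define Z where "Z = {y \<in> Y. map (s y) y = [0, 0, 0]}"
  have "card (Y - Z) \<le> card (X \<times> {0, 1, 2::nat})"
  proof (rule dual_system_card_le)
    \<comment> \<open>\<open>f y\<close> carries the coefficients of the linear equation at the
      entries of \<open>y\<close>, and \<open>g z\<close> the embedded values under the witness of
      \<open>z\<close>; their pairing is the equation for \<open>y\<close> under that witness. The
      index \<open>j\<close> keeps repeated variables apart.\<close>
    define f where "f y = (\<lambda>(x, j). if x = y ! j then if j = (2::nat) then - 1 else 1 else 0 :: complex)"
      for y :: "'v list"
    define g where "g z = (\<lambda>(x, j). if j = (0::nat) then unity_root m (2 * s z x + 1)
      else if j = 1 then unity_root m (2 * s z x) else unity_root m (- s z x) + unity_root m (1 - s z x))" for z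
    fix y z assume yz: "y \<in> Y - Z" "z \<in> Y - Z"
    have y: "y \<in> Y" and z: "z \<in> Y"
      using yz by auto
    let ?a = "s z (y ! 0)" and ?b = "s z (y ! 1)" and ?c = "s z (y ! 2)"
    have "(\<Sum>i\<in>X \<times> {0, 1, 2}. f y i * g z i) = (\<Sum>j\<in>{0, 1, 2}. \<Sum>x\<in>X. f y (x, j) * g z (x, j))"
      by (subst sum.swap) (simp only: sum.cartesian_product split_def prod.collapse)
    also have "\<dots> = (\<Sum>j\<in>{0, 1, 2}. (if j = 2 then - 1 else 1) * g z (y ! j, j))"
    proof (rule sum.cong[OF refl])
      fix j :: nat assume "j \<in> {0, 1, 2}"
      then have "y ! j \<in> X"
        using Y[OF y] by auto
      have "(\<Sum>x\<in>X. f y (x, j) * g z (x, j))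
          = (\<Sum>x\<in>X. if x = y ! j then (if j = 2 then - 1 else 1) * g z (y ! j, j) else 0)"
        by (intro sum.cong) (auto simp: f_def)
      then show "(\<Sum>x\<in>X. f y (x, j) * g z (x, j)) = (if j = 2 then - 1 else 1) * g z (y ! j, j)"
        using \<open>finite X\<close> \<open>y ! j \<in> X\<close> by simp
    qed
    also have "\<dots> = unity_root m (2 * ?a + 1) + unity_root m (2 * ?b) - (unity_root m (- ?c) + unity_root m (1 - ?c))"
      by (simp add: g_def)
    also have "\<dots> = 0 \<longleftrightarrow> (?a + ?b + ?c) mod int m = 0 \<and> (?b - ?a) mod int m \<in> {0, 1}"
      using unity_root_equation[OF \<open>odd m\<close>, of ?a ?b ?c] m by simp
    \<comment> \<open>For \<open>y \<noteq> z\<close> the witness of \<open>z\<close> satisfies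
      \<open>y\<close>; for \<open>y = z\<close> outside \<open>Z\<close> it violates even the
      relation with the zero tuple restored.\<close>
    also have "\<dots> \<longleftrightarrow> y \<noteq> z"
    proof (cases "y = z")
      case True
      have "?a \<in> Zmod m" "?b \<in> Zmod m" "?c \<in> Zmod m"
        using s(1)[OF z] Y[OF y] by (auto simp: Pi_iff)
      then show ?thesis
        using s(3)[OF z] yz True map_Y[OF y, of "s z"] by (auto simp: CYC_star_iff Z_def)
    next
      case False
      with sat[OF z y] show ?thesis
        by (simp add: CYC_star_iff)
    qed
    finally show "(\<Sum>i\<in>X \<times> {0, 1, 2}. f y i * g z i) = 0 \<longleftrightarrow> y \<noteq> z" .
  qed (use \<open>finite X\<close> in simp)
  also have "\<dots> = 3 * card X"
    by (simp add: card_cartesian_product)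
  finally have linear: "card (Y - Z) \<le> 3 * card X" .

  define edge :: "'v list \<Rightarrow> ('v + 'v) set" where "edge y = {Inl (y ! 0), Inr (y ! 1)}" for y
  have Z: "y \<in> Y" "s y (y ! 0) = 0" "s y (y ! 1) = 0" if "y \<in> Z" for y
  proof -
    show "y \<in> Y"
      using that by (simp add: Z_def)
    show "s y (y ! 0) = 0" "s y (y ! 1) = 0"
      using that map_Y[OF \<open>y \<in> Y\<close>, of "s y"] by (auto simp: Z_def)
  qed
  have pos_edge: "\<bar>path_pos m (s y) (Inl (z ! 0)) - path_pos m (s y) (Inr (z ! 1))\<bar> \<le> 1"
    if "y \<in> Z" "z \<in> Z" "y \<noteq> z" for y z
    by (rule path_pos_edge) (use sat[of y z] Z that in auto)
  have pos_ends: "path_pos m (s y) (Inl (y ! 0)) = 0" "path_pos m (s y) (Inr (y ! 1)) = 2 * int m - 1"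
    if "y \<in> Z" for y
    using Z[OF that] by (auto simp: path_pos_def)
  \<comment> \<open>If \<open>y\<close> and \<open>z\<close> shared an edge, its ends would have
    positions \<open>2 * m - 1\<close> apart under the witness of \<open>y\<close>, but at most
    \<open>1\<close> apart because that witness satisfies \<open>z\<close>.\<close>
  have inj: "inj_on edge Z"
  proof (rule inj_onI, rule ccontr)
    fix y z assume yz: "y \<in> Z" "z \<in> Z" "edge y = edge z" "y \<noteq> z"
    then have "y ! 0 = z ! 0" "y ! 1 = z ! 1"
      by (auto simp: edge_def doubleton_eq_iff)
    with pos_edge[OF yz(1,2,4)] pos_ends[OF yz(1)] m show False
      by simp
  qed
  \<comment> \<open>Under the witness of \<open>y\<close> the ends of its edge are
    \<open>2 * m - 1\<close> apart and each step along other edges moves by at most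
    \<open>1\<close>, so a detour has at least \<open>2 * m\<close> vertices.\<close>
  have "long_detours (2 * (m - 1)) (edge ` Z)"
    unfolding long_detours_def
  proof (intro allI impI)
    fix u v p
    assume uv: "{u, v} \<in> edge ` Z" and p: "p \<noteq> []" "hd p = u" "last p = v"
      and walk: "successively (\<lambda>a b. {a, b} \<in> edge ` Z - {{u, v}}) p"
    from uv obtain y where y: "y \<in> Z" "{u, v} = edge y"
      by auto
    let ?f = "path_pos m (s y)"
    have "successively (\<lambda>a b. \<bar>?f a - ?f b\<bar> \<le> 1) p"
    proof (rule successively_mono[OF walk])
      fix a b assume "{a, b} \<in> edge ` Z - {{u, v}}"
      then obtain z where z: "z \<in> Z" "{a, b} = edge z" "y \<noteq> z"
        using y by auto
      then have "a = Inl (z ! 0) \<and> b = Inr (z ! 1) \<or> a = Inr (z ! 1) \<and> b = Inl (z ! 0)"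
        by (auto simp: edge_def doubleton_eq_iff)
      then show "\<bar>?f a - ?f b\<bar> \<le> 1"
        using pos_edge[OF y(1) z(1,3)] by (auto simp: abs_minus_commute)
    qed
    from abs_walk_le[OF this p(1)] have "\<bar>?f v - ?f u\<bar> < int (length p)"
      using p by simp
    moreover have "u = Inl (y ! 0) \<and> v = Inr (y ! 1) \<or> u = Inr (y ! 1) \<and> v = Inl (y ! 0)"
      using y by (auto simp: edge_def doubleton_eq_iff)
    ultimately show "2 * (m - 1) < length p"
      using pos_ends[OF y(1)] m by auto
  qed
  moreover have cardV: "card (X <+> X) = 2 * card X"
    using \<open>finite X\<close> by (simp add: card_Plus)
  moreover have "e \<subseteq> X <+> X \<and> card e = 2" if "e \<in> edge ` Z" for e
    using that Z Y by (auto simp: edge_def)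
  ultimately have "card (edge ` Z) \<le> d * card (X <+> X)"
    using \<open>finite X\<close> d by (intro moore_bound) auto
  then have "card Z \<le> d * (2 * card X)"
    by (simp add: card_image[OF inj] cardV)
  moreover have "card Y = card (Y - Z) + card Z"
    using \<open>finite Y\<close> by (subst card_Diff_subset) (auto simp: Z_def card_mono)
  ultimately show ?thesis
    using linear by simp
qed

section \<open>From bounds on instances to the growth of \<open>NRD\<close>\<close>

lemma NRD_le:
  assumes "\<And>(X :: nat set) Y. card X = n \<Longrightarrow> csp_instance r X Y \<Longrightarrow> nonredundant D R X Y \<Longrightarrow> card Y \<le> N"
  shows "NRD D r R n \<le> N"
proof -
  let ?A = "{card Y | (X :: nat set) Y. card X = n \<and> csp_instance r X Y \<and> nonredundant D R X Y}"
  have "?A \<subseteq> {..N}"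
    using assms by auto
  then have "finite ?A"
    by (rule finite_subset) simp
  moreover have "card ({} :: nat list set) \<in> ?A"
    by (intro CollectI exI[of _ "{..<n}"] exI[of _ "{}"])
      (simp add: csp_instance_def nonredundant_def)
  ultimately have "NRD D r R n \<in> ?A"
    unfolding NRD_def by (intro Max_in) auto
  then show ?thesis
    using assms by auto
qed

lemma NRD_CYC_star_bigo:
  assumes "m \<ge> 3" "odd m"
  shows "(\<lambda>n. real (NRD (Zmod m) 3 (CYC_star m) n)) \<in> O(\<lambda>n. real n powr (real m / (real m - 1)))"
proof (rule bigoI[of _ 11], rule eventually_mono[OF eventually_ge_at_top[of 1]])
  fix n :: nat assume n: "1 \<le> n"
  define k where "k = m - 1"
  define q where "q = 1 / real k"
  have k: "0 < k" "real k = real m - 1"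
    using assms by (auto simp: k_def)
  have q: "0 < q" "q \<le> 1" "real m / (real m - 1) = 1 + q"
    using k by (auto simp: q_def field_simps)
  \<comment> \<open>Just above the \<open>(m - 1)\<close>-th root of \<open>2 * n\<close>, to meet
    the hypothesis of the Moore bound.\<close>
  define d where "d = nat \<lfloor>real (2 * n) powr q\<rfloor> + 1"
  have d: "real (2 * n) powr q < real d" "real d \<le> real (2 * n) powr q + 1"
  proof -
    have "real (nat \<lfloor>real (2 * n) powr q\<rfloor>) = of_int \<lfloor>real (2 * n) powr q\<rfloor>"
      by (simp del: of_nat_mult)
    then show "real (2 * n) powr q < real d" "real d \<le> real (2 * n) powr q + 1"
      unfolding d_def by linarith+
  qed
  have "real (2 * n) = (real (2 * n) powr q) ^ k"
    using n k by (simp add: q_def powr_powr flip: powr_realpow)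
  also have "\<dots> < real d ^ k"
    using d k by (intro power_strict_mono) auto
  finally have "2 * n < d ^ (m - 1)"
    unfolding k_def by (simp only: of_nat_less_iff flip: of_nat_power)
  then have "NRD (Zmod m) 3 (CYC_star m) n \<le> 3 * n + d * (2 * n)"
    using card_nonredundant_le[OF assms] by (intro NRD_le) auto
  then have "real (NRD (Zmod m) 3 (CYC_star m) n) \<le> real (3 * n + d * (2 * n))"
    by (simp only: of_nat_le_iff)
  also have "\<dots> = 3 * real n + real d * (2 * real n)"
    by simp
  \<comment> \<open>\<open>(2n)^q \<le> 2 n^q\<close> and \<open>1 \<le> n^q\<close> give
    \<open>d \<le> 4 n^q\<close>; the constant is \<open>3 + 4 * 2 = 11\<close>.\<close>
  also have "\<dots> \<le> 3 * (real n * real n powr q) + (4 * real n powr q) * (2 * real n)"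
  proof (intro add_mono mult_left_mono mult_right_mono)
    have 1: "1 \<le> real n powr q"
      using n q by (intro ge_one_powr_ge_zero) auto
    then show "real n \<le> real n * real n powr q"
      using mult_left_mono[OF 1, of "real n"] by simp
    have "(2::real) powr q \<le> 2 powr 1"
      using q by (intro powr_mono) auto
    then have "2 powr q * real n powr q \<le> 2 * real n powr q"
      by (intro mult_right_mono) auto
    then have "real (2 * n) powr q \<le> 2 * real n powr q"
      by (simp add: powr_mult)
    with d 1 show "real d \<le> 4 * real n powr q"
      by linarith
  qed auto
  also have "\<dots> = 11 * real n powr (1 + q)"
    using n by (simp add: powr_add algebra_simps)
  finally show "norm (real (NRD (Zmod m) 3 (CYC_star m) n)) \<le> 11 * norm (real n powr (real m / (real m - 1)))"
    by (simp add: q)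
qed

theorem theorem1p5:
  fixes m :: nat
  assumes "m \<ge> 3" and "odd m"
  shows "(\<lambda>n. real (NRD (Zmod m) 3 (CYC_star m) n))
           \<in> O(\<lambda>n. real n powr (real m / (real m - 1))) \<and>
         \<not> admits_maltsev_embedding TYPE('e) (Zmod m) 3 (CYC_star m)"
proof
  show "\<not> admits_maltsev_embedding TYPE('e) (Zmod m) 3 (CYC_star m)"
  proof (rule not_admits_maltsev_embedding)
    show "generates (CYC_star m) [0] [0] [0]"
      using assms by (intro generates_CYC_star) auto
    show "CYC_star m \<subseteq> nlists 3 (Zmod m)"
    proof
      fix t assume "t \<in> CYC_star m"
      then obtain a b c where "t = [a, b, c]" "a \<in> Zmod m" "b \<in> Zmod m" "c \<in> Zmod m"
        unfolding CYC_star_def by blast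
      then show "t \<in> nlists 3 (Zmod m)"
        by (intro nlistsI) auto
    qed
    show "[0, 0, 0] \<in> nlists 3 (Zmod m)"
      using assms by (intro nlistsI) (auto simp: Zmod_def)
    show "[0, 0, 0] \<notin> CYC_star m"
      by (simp only: CYC_star_iff) simp
  qed
qed (rule NRD_CYC_star_bigo[OF assms])

end
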